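(* Let $K,K'\subset\mathbb{R}^d$ be bounded and let $C\subset\mathbb{R}^d$ be a compact convex set with $0\in\operatorname{int}(C)$. (a) Let $\lambda\geq R(K',C)$ and $K\subseteq K'$. Then $\operatorname{bi}(K,C,\lambda)\supseteq\operatorname{bi}(K',C,\lambda)$ and $\operatorname{bh}(K,C,\lambda)\subseteq\operatorname{bh}(K',C,\lambda)$. (b) If $R(K,C)\leq\lambda\leq\lambda'$, then $\operatorname{bi}(K,C,\lambda)\subseteq\operatorname{bi}(K,C,\lambda')$ and $\operatorname{bh}(K,C,\lambda)\supseteq\operatorname{bh}(K,C,\lambda')$. (c) Let $\lambda\ge R(K,C)$. If $\operatorname{bh}(K,C,\lambda)\neq\emptyset$ and $\operatorname{bi}(K,C,\lambda)\neq\emptyset$, then $\operatorname{bh}(K,C,\lambda)=\operatorname{bi}(\operatorname{bi}(K,C,\lambda),-C,\lambda)$ and $\operatorname{bi}(K,C,\lambda)=\operatorname{bi}(\operatorname{bh}(K,C,\lambda),C,\lambda)$. (d) If $\sup\{\gamma_C(x-y) : x,y\in K\}=\lambda$, then $\operatorname{bh}(K,C,\lambda)\subseteq\operatorname{bi}(K,-C,\lambda)$.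
   Context: The Minkowski functional of $C$ is $\gamma_C(x)=\inf\{\lambda>0 : x\in\lambda C\}$. The circumradius of $K\subseteq\mathbb{R}^d$ with respect to $C$ is $R(K,C)=\inf_{x\in\mathbb{R}^d}\inf\{\lambda>0 : K\subseteq x+\lambda C\}$. For a bounded set $K\subset\mathbb{R}^d$, a compact convex set $C\subset\mathbb{R}^d$ with $0\in\operatorname{int}(C)$, and $\lambda\geq R(K,C)$, the ball intersection and the ball hull of $K$ with respect to $C$ are $$\operatorname{bi}(K,C,\lambda)=\bigcap_{x\in K}(x-\lambda C),\qquad \operatorname{bh}(K,C,\lambda)=\bigcap_{x\in\mathbb{R}^d:\,K\subseteq x+\lambda C}(x+\lambda C).$$ An intersection over an empty index set is $\mathbb{R}^d$. *)

theory Defs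
  imports "HOL-Analysis.Analysis"
begin

definition scale :: "real \<Rightarrow> (real ^ 'n) set \<Rightarrow> (real ^ 'n) set" where
  "scale r C = (\<lambda>c. r *\<^sub>R c) ` C"

definition translate :: "real ^ 'n \<Rightarrow> (real ^ 'n) set \<Rightarrow> (real ^ 'n) set" where
  "translate x A = (\<lambda>a. x + a) ` A"

definition reflect :: "(real ^ 'n) set \<Rightarrow> (real ^ 'n) set" where
  "reflect A = uminus ` A"

text \<open>The infima in the next two definitions are taken in the reals. They have their usual
  meaning when \<open>C\<close> has the origin in its interior and \<open>K\<close> is bounded: the sets involved are
  then nonempty, and \<open>0\<close> is a lower bound.\<close>

definition minkowski_functional :: "(real ^ 'n) set \<Rightarrow> real ^ 'n \<Rightarrow> real" where
  "minkowski_functional C x = Inf {r. r > 0 \<and> x \<in> scale r C}"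

definition circumradius :: "(real ^ 'n) set \<Rightarrow> (real ^ 'n) set \<Rightarrow> real" where
  "circumradius K C = (INF x. Inf {r. r > 0 \<and> K \<subseteq> translate x (scale r C)})"

text \<open>The next two definitions are total; the side condition \<open>r \<ge> circumradius K C\<close> is imposed
  where they are used. An intersection over an empty index set is \<open>UNIV\<close>.\<close>

definition ball_intersection :: "(real ^ 'n) set \<Rightarrow> (real ^ 'n) set \<Rightarrow> real \<Rightarrow> (real ^ 'n) set" where
  "ball_intersection K C r = (\<Inter>x\<in>K. translate x (reflect (scale r C)))"

definition ball_hull :: "(real ^ 'n) set \<Rightarrow> (real ^ 'n) set \<Rightarrow> real \<Rightarrow> (real ^ 'n) set" where
  "ball_hull K C r =
    (\<Inter>x\<in>{x. K \<subseteq> translate x (scale r C)}. translate x (scale r C))"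

end

theory Submission
  imports Defs
begin

text \<open>Everything but two points is the Galois connection behind \<open>y \<in> bi(K, C, r) \<longleftrightarrow> K \<subseteq> y + r C\<close>.
  Monotonicity of \<open>bh\<close> in the radius rests on \<open>r C\<close> being, for \<open>0 \<le> r \<le> r'\<close>, an intersection of
  translates of \<open>r' C\<close>: a point \<open>v\<close> outside \<open>r C\<close> is cut off by \<open>(r - r') c + r' C\<close>, where \<open>c\<close> is the
  boundary point of \<open>C\<close> on the ray through \<open>v\<close>. For the last part, compactness gives
  \<open>x - y \<in> r C\<close> as soon as \<open>\<gamma>\<^sub>C(x - y) \<le> r\<close>, so \<open>K \<subseteq> y + r C\<close> for every \<open>y \<in> K\<close>.\<close>

section \<open>Membership in scaled, translated and reflected sets\<close>

lemma mem_scale: "v \<in> scale r C \<longleftrightarrow> (\<exists>c\<in>C. v = r *\<^sub>R c)"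
  by (auto simp: scale_def)

lemma mem_translate: "y \<in> translate x A \<longleftrightarrow> y - x \<in> A"
proof
  assume "y - x \<in> A"
  then show "y \<in> translate x A"
    unfolding translate_def by (intro image_eqI[of _ _ "y - x"]) auto
qed (auto simp: translate_def)

lemma mem_reflect: "y \<in> reflect A \<longleftrightarrow> - y \<in> A"
  by (force simp: reflect_def)

lemma reflect_scale_reflect: "reflect (scale r (reflect C)) = scale r C"
  by (force simp: mem_reflect mem_scale reflect_def)

text \<open>\<open>y - x\<close> lies in \<open>- r C\<close> exactly when \<open>x - y\<close> lies
  in \<open>r C\<close>, so a point of the ball intersection is a centre whose translate of
  \<open>r C\<close> covers \<open>K\<close>.\<close>

lemma mem_ball_intersection:
  "y \<in> ball_intersection K C r \<longleftrightarrow> K \<subseteq> translate y (scale r C)"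
  by (auto simp: ball_intersection_def mem_translate mem_reflect)

lemma mem_ball_intersection_reflect:
  "z \<in> ball_intersection K (reflect C) r \<longleftrightarrow> (\<forall>y\<in>K. z \<in> translate y (scale r C))"
  by (simp add: ball_intersection_def reflect_scale_reflect)

lemma mem_ball_hull:
  "z \<in> ball_hull K C r \<longleftrightarrow> (\<forall>y. K \<subseteq> translate y (scale r C) \<longrightarrow> z \<in> translate y (scale r C))"
  by (auto simp: ball_hull_def)

section \<open>Monotonicity in the set and duality of hull and intersection\<close>

lemma ball_intersection_antimono:
  "K \<subseteq> K' \<Longrightarrow> ball_intersection K' C r \<subseteq> ball_intersection K C r"
  by (auto simp: ball_intersection_def)

lemma ball_hull_mono: "K \<subseteq> K' \<Longrightarrow> ball_hull K C r \<subseteq> ball_hull K' C r"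
  by (auto simp: ball_hull_def)

text \<open>The centres that index the hull are the points of
  \<open>ball_intersection K C r\<close>. The outer \<open>C\<close> is reflected to cancel the
  reflection built into \<open>ball_intersection\<close>.\<close>

lemma ball_hull_eq_ball_intersection:
  "ball_hull K C r = ball_intersection (ball_intersection K C r) (reflect C) r"
  by (rule set_eqI, simp only: mem_ball_hull mem_ball_intersection_reflect)
    (simp add: Ball_def mem_ball_intersection)

lemma subset_ball_hull: "K \<subseteq> ball_hull K C r"
  by (auto simp: mem_ball_hull)

text \<open>A translate of \<open>r C\<close> that covers \<open>K\<close> also covers the hull, so
  both sets have the same centres.\<close>

lemma ball_intersection_ball_hull:
  "ball_intersection (ball_hull K C r) C r = ball_intersection K C r"
proof
  show "ball_intersection (ball_hull K C r) C r \<subseteq> ball_intersection K C r"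
    by (rule ball_intersection_antimono[OF subset_ball_hull])
  show "ball_intersection K C r \<subseteq> ball_intersection (ball_hull K C r) C r"
    by (auto simp: mem_ball_intersection mem_ball_hull)
qed

section \<open>Dependence on the radius\<close>

lemma convex_scaleR_mem:
  fixes C :: "'a::real_vector set"
  assumes "convex C" "0 \<in> C" "c \<in> C" "0 \<le> t" "t \<le> 1"
  shows "t *\<^sub>R c \<in> C"
  using convexD_alt[OF assms(1-5)] by simp

lemma scale_mono:
  assumes "convex C" "0 \<in> C" "0 \<le> r" "r \<le> r'"
  shows "scale r C \<subseteq> scale r' C"
proof
  fix v assume "v \<in> scale r C"
  then obtain c where c: "c \<in> C" "v = r *\<^sub>R c" by (auto simp: mem_scale)
  show "v \<in> scale r' C"
  proof (cases "r' = 0")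
    case True
    with assms c show ?thesis by (auto simp: mem_scale)
  next
    case False
    with assms have "(r / r') *\<^sub>R c \<in> C" "v = r' *\<^sub>R ((r / r') *\<^sub>R c)"
      using c by (simp_all add: convex_scaleR_mem)
    then show ?thesis unfolding mem_scale by blast
  qed
qed

lemma ball_intersection_mono_radius:
  assumes "convex C" "0 \<in> C" "0 \<le> r" "r \<le> r'"
  shows "ball_intersection K C r \<subseteq> ball_intersection K C r'"
  using scale_mono[OF assms] by (auto simp: mem_ball_intersection mem_translate subset_iff)

text \<open>\<open>v / r\<close> has norm at most \<open>e\<close>. This turns a ball inside
  \<open>C\<close> into explicit covering radii.\<close>

lemma mem_scale_of_norm_le:
  assumes "cball 0 e \<subseteq> C" "r > 0" "norm v \<le> e * r"
  shows "v \<in> scale r C"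
proof -
  have "(1 / r) *\<^sub>R v \<in> C"
    using assms by (intro subsetD[OF assms(1)]) (simp add: field_simps)
  moreover have "v = r *\<^sub>R ((1 / r) *\<^sub>R v)" using assms by simp
  ultimately show ?thesis unfolding mem_scale by blast
qed

text \<open>The real infimum of an empty set is unspecified, so each centre needs an explicit
  covering radius before the lower bound 0 carries over to \<open>Inf\<close>.\<close>

lemma circumradius_nonneg:
  fixes K C :: "(real ^ 'n) set"
  assumes "bounded K" "0 \<in> interior C"
  shows "circumradius K C \<ge> 0"
  unfolding circumradius_def
proof (rule cINF_greatest)
  fix x :: "real ^ 'n"
  obtain e where e: "e > 0" "cball 0 e \<subseteq> C"
    using assms(2) by (auto simp: mem_interior_cball)
  obtain B where B: "B > 0" "\<And>y. y \<in> K \<Longrightarrow> norm y \<le> B"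
    using assms(1) by (auto simp: bounded_pos)
  \<comment> \<open>Chosen so that \<open>e * r = B + norm x\<close>, which bounds
    \<open>norm (y - x)\<close> on \<open>K\<close>.\<close>
  define r where "r = (B + norm x) / e"
  have "r > 0" using e B by (simp add: r_def add_pos_nonneg)
  moreover have "K \<subseteq> translate x (scale r C)"
  proof
    fix y assume "y \<in> K"
    have "norm (y - x) \<le> e * r"
      using norm_triangle_ineq4[of y x] B(2)[OF \<open>y \<in> K\<close>] e by (simp add: r_def)
    then show "y \<in> translate x (scale r C)"
      using mem_scale_of_norm_le[OF e(2) \<open>r > 0\<close>] by (simp add: mem_translate)
  qed
  ultimately show "0 \<le> Inf {r. r > 0 \<and> K \<subseteq> translate x (scale r C)}"
    by (intro cInf_greatest) auto
qed simp

lemma scale_separating_translate: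
  assumes "compact C" "convex C" "0 \<in> interior C" "0 \<le> r" "r \<le> r'" "v \<notin> scale r C"
  obtains t where "scale r C \<subseteq> translate t (scale r' C)" "v \<notin> translate t (scale r' C)"
proof (cases "r = r'")
  case True
  then show ?thesis using assms(6) by (intro that[of 0]) (auto simp: mem_translate)
next
  case False
  then have r': "r < r'" "0 < r'" using assms by auto
  have C0: "0 \<in> C" using assms(3) interior_subset by auto
  have "v \<noteq> 0" using assms(6) C0 by (auto simp: mem_scale)
  then obtain s where s: "0 < s" "s *\<^sub>R v \<in> frontier C"
    using ray_to_frontier[OF compact_imp_bounded[OF assms(1)] assms(3)] by force
  then have sC: "s *\<^sub>R v \<in> C" "s *\<^sub>R v \<notin> interior C"
    using compact_imp_closed[OF assms(1)] by (auto simp: frontier_def)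
  \<comment> \<open>Contracting \<open>u v\<close> towards the interior point 0 by the factor
    \<open>s / u\<close> would put the boundary point \<open>s v\<close> into the interior.\<close>
  have max: "u *\<^sub>R v \<notin> C" if "s < u" for u
  proof
    assume "u *\<^sub>R v \<in> C"
    then have "u *\<^sub>R v - (1 - s / u) *\<^sub>R (u *\<^sub>R v - 0) \<in> interior C"
      using that s by (intro mem_interior_convex_shrink[OF assms(2,3)]) auto
    moreover have "u *\<^sub>R v - (1 - s / u) *\<^sub>R (u *\<^sub>R v - 0) = s *\<^sub>R v"
      using that s by (simp add: algebra_simps)
    ultimately show False using sC by simp
  qed
  \<comment> \<open>Otherwise \<open>v / r\<close> is a contraction of \<open>s v\<close>, hence in
    \<open>C\<close>, and \<open>v\<close> would lie in \<open>r C\<close>.\<close>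
  have rs: "r * s < 1"
  proof (rule ccontr)
    assume "\<not> r * s < 1"
    then have "r > 0" using assms(4) by (cases "r = 0") auto
    moreover have "(1 / (r * s)) *\<^sub>R (s *\<^sub>R v) \<in> C"
      by (rule convex_scaleR_mem[OF assms(2) C0 sC(1)])
        (use s \<open>r > 0\<close> \<open>\<not> r * s < 1\<close> in auto)
    moreover have "v = r *\<^sub>R ((1 / (r * s)) *\<^sub>R (s *\<^sub>R v))"
      using s \<open>r > 0\<close> by simp
    ultimately show False using assms(6) by (auto simp: mem_scale)
  qed
  let ?t = "(r - r') *\<^sub>R (s *\<^sub>R v)"
  show ?thesis
  proof (rule that[of ?t])
    show "scale r C \<subseteq> translate ?t (scale r' C)"
    proof
      fix w assume "w \<in> scale r C"
      then obtain c where c: "c \<in> C" "w = r *\<^sub>R c" by (auto simp: mem_scale)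
      \<comment> \<open>The weights are those for which \<open>r' C\<close> contains
        \<open>r c + (r' - r) s v\<close>.\<close>
      have "(r / r') *\<^sub>R c + (1 - r / r') *\<^sub>R (s *\<^sub>R v) \<in> C"
        using assms r' c sC by (intro convexD[OF assms(2)]) auto
      moreover have "w - ?t = r' *\<^sub>R ((r / r') *\<^sub>R c + (1 - r / r') *\<^sub>R (s *\<^sub>R v))"
        using r' c by (simp add: algebra_simps)
      ultimately show "w \<in> translate ?t (scale r' C)"
        unfolding mem_translate mem_scale by blast
    qed
    show "v \<notin> translate ?t (scale r' C)"
    proof
      assume "v \<in> translate ?t (scale r' C)"
      then obtain c where c: "c \<in> C" "v - ?t = r' *\<^sub>R c"
        by (auto simp: mem_translate mem_scale)
      have "c = (1 / r') *\<^sub>R (v - ?t)" using c r' by simp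
      also have "\<dots> = ((1 + (r' - r) * s) / r') *\<^sub>R v"
        using r' by (simp add: algebra_simps add_divide_distrib diff_divide_distrib)
      finally have "((1 + (r' - r) * s) / r') *\<^sub>R v \<in> C" using c by simp
      \<comment> \<open>After clearing \<open>r'\<close>, this inequality is
        \<open>r * s < 1\<close>.\<close>
      moreover have "s < (1 + (r' - r) * s) / r'"
        using rs r' by (simp add: field_simps)
      ultimately show False using max by blast
    qed
  qed
qed

lemma ball_hull_antimono_radius:
  assumes "compact C" "convex C" "0 \<in> interior C" "0 \<le> r" "r \<le> r'"
  shows "ball_hull K C r' \<subseteq> ball_hull K C r"
proof
  fix z assume z: "z \<in> ball_hull K C r'"
  show "z \<in> ball_hull K C r"
    unfolding mem_ball_hull
  proof (intro allI impI, rule ccontr)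
    fix y assume K: "K \<subseteq> translate y (scale r C)" and "z \<notin> translate y (scale r C)"
    then have "z - y \<notin> scale r C" by (simp add: mem_translate)
    then obtain t where
      t: "scale r C \<subseteq> translate t (scale r' C)" "z - y \<notin> translate t (scale r' C)"
      by (rule scale_separating_translate[OF assms])
    \<comment> \<open>Shifting the separating translate by \<open>y\<close> gives a set of radius
      \<open>r'\<close> that covers \<open>K\<close> but misses \<open>z\<close>.\<close>
    have "K \<subseteq> translate (y + t) (scale r' C)"
      using K t(1) by (auto simp: mem_translate subset_iff diff_diff_eq)
    with z have "z \<in> translate (y + t) (scale r' C)" by (auto simp: mem_ball_hull)
    with t(2) show False by (simp add: mem_translate diff_diff_eq)
  qed
qed

section \<open>The Minkowski functional and the diameter\<close>

lemma minkowski_functional_le: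
  assumes "r > 0" "v \<in> scale r C"
  shows "minkowski_functional C v \<le> r"
  unfolding minkowski_functional_def
  by (rule cInf_lower) (use assms in \<open>auto intro!: bdd_belowI[of _ 0]\<close>)

lemma mem_scale_exists:
  assumes "0 \<in> interior C"
  shows "\<exists>r>0. v \<in> scale r C"
proof -
  obtain e where e: "e > 0" "cball 0 e \<subseteq> C"
    using assms by (auto simp: mem_interior_cball)
  \<comment> \<open>The summand 1 keeps the radius positive when \<open>v = 0\<close>.\<close>
  have "v \<in> scale ((norm v + 1) / e) C" "(norm v + 1) / e > 0"
    using e by (auto intro!: mem_scale_of_norm_le[OF e(2)] divide_pos_pos add_nonneg_pos)
  then show ?thesis by blast
qed

lemma minkowski_functional_nonneg:
  assumes "0 \<in> interior C"
  shows "minkowski_functional C v \<ge> 0"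
  unfolding minkowski_functional_def
  using mem_scale_exists[OF assms, of v] by (intro cInf_greatest) auto

text \<open>Radii slightly above \<open>r\<close> work by the definition of the infimum; compactness
  of \<open>C\<close> lets them decrease to \<open>r\<close> itself, including
  \<open>r = 0\<close>.\<close>

lemma mem_scale_of_minkowski_functional_le:
  assumes "compact C" "convex C" "0 \<in> interior C" "minkowski_functional C v \<le> r"
  shows "v \<in> scale r C"
proof -
  have C0: "0 \<in> C" using assms(3) interior_subset by auto
  have r: "r \<ge> 0" using minkowski_functional_nonneg[OF assms(3), of v] assms(4) by simp
  have "\<exists>c\<in>C. v = (r + inverse (real (Suc n))) *\<^sub>R c" for n
  proof -
    have less: "Inf {r. r > 0 \<and> v \<in> scale r C} < r + inverse (real (Suc n))"
      using assms(4) unfolding minkowski_functional_def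
      by (simp add: le_less_trans)
    have "{r. r > 0 \<and> v \<in> scale r C} \<noteq> {}"
      using mem_scale_exists[OF assms(3), of v] by auto
    from cInf_lessD[OF this less]
    obtain q where q: "q > 0" "v \<in> scale q C" "q < r + inverse (real (Suc n))"
      by blast
    have "scale q C \<subseteq> scale (r + inverse (real (Suc n))) C"
      using q by (intro scale_mono[OF assms(2) C0]) simp_all
    with q have "v \<in> scale (r + inverse (real (Suc n))) C" by blast
    then show ?thesis by (simp add: mem_scale)
  qed
  then have "\<exists>c. \<forall>n. c n \<in> C \<and> v = (r + inverse (real (Suc n))) *\<^sub>R c n"
    by (intro choice) blast
  then obtain c where c: "\<And>n. c n \<in> C" "\<And>n. v = (r + inverse (real (Suc n))) *\<^sub>R c n"
    by blast
  obtain l \<phi> where l: "l \<in> C" "strict_mono (\<phi> :: nat \<Rightarrow> nat)" "(c \<circ> \<phi>) \<longlonglongrightarrow> l"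
    using seq_compactE[OF assms(1)[unfolded compact_eq_seq_compact_metric], of c] c(1) by blast
  have "(\<lambda>n. inverse (real (Suc (\<phi> n)))) \<longlonglongrightarrow> 0"
    using LIMSEQ_subseq_LIMSEQ[OF LIMSEQ_inverse_real_of_nat l(2)] by (simp add: o_def)
  \<comment> \<open>Each term of this sequence equals \<open>v\<close>, so its limit
    \<open>r l\<close> is \<open>v\<close>.\<close>
  then have "(\<lambda>n. (r + inverse (real (Suc (\<phi> n)))) *\<^sub>R (c \<circ> \<phi>) n) \<longlonglongrightarrow> (r + 0) *\<^sub>R l"
    by (intro tendsto_intros l(3))
  then have "(\<lambda>n. v) \<longlonglongrightarrow> r *\<^sub>R l" using c(2) by simp
  then have "v = r *\<^sub>R l" by (simp add: LIMSEQ_const_iff)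
  with l(1) show ?thesis by (auto simp: mem_scale)
qed

text \<open>Differences of points of \<open>K\<close> have norm at most \<open>2 * B\<close>. The
  bound makes the real \<open>Sup\<close> a genuine upper bound.\<close>

lemma bdd_above_minkowski_functional_diff:
  assumes "bounded K" "0 \<in> interior C"
  shows "bdd_above {minkowski_functional C (x - y) | x y. x \<in> K \<and> y \<in> K}"
proof -
  obtain e where e: "e > 0" "cball 0 e \<subseteq> C"
    using assms(2) by (auto simp: mem_interior_cball)
  obtain B where B: "B > 0" "\<And>y. y \<in> K \<Longrightarrow> norm y \<le> B"
    using assms(1) by (auto simp: bounded_pos)
  have "minkowski_functional C (x - y) \<le> 2 * B / e" if "x \<in> K" "y \<in> K" for x y
  proof (rule minkowski_functional_le)
    show "2 * B / e > 0" using e B by simp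
    then show "x - y \<in> scale (2 * B / e) C"
      using e norm_triangle_ineq4[of x y] B(2)[OF that(1)] B(2)[OF that(2)]
      by (intro mem_scale_of_norm_le[OF e(2)]) auto
  qed
  then show ?thesis unfolding bdd_above_def by blast
qed

lemma ball_hull_subset_ball_intersection_reflect:
  assumes "bounded K" "compact C" "convex C" "0 \<in> interior C"
    and "Sup {minkowski_functional C (x - y) | x y. x \<in> K \<and> y \<in> K} = r"
  shows "ball_hull K C r \<subseteq> ball_intersection K (reflect C) r"
proof -
  have "x - y \<in> scale r C" if "x \<in> K" "y \<in> K" for x y
  proof (rule mem_scale_of_minkowski_functional_le[OF assms(2-4)])
    show "minkowski_functional C (x - y) \<le> r"
      unfolding assms(5)[symmetric]
      using that by (intro cSup_upper bdd_above_minkowski_functional_diff assms) auto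
  qed
  then have "K \<subseteq> translate y (scale r C)" if "y \<in> K" for y
    using that by (auto simp: mem_translate)
  then show ?thesis by (auto simp: mem_ball_hull mem_ball_intersection_reflect)
qed

theorem theorem4p2:
  fixes K K' C :: "(real ^ 'n) set"
  assumes "bounded K" and "bounded K'"
    and "compact C" and "convex C" and "0 \<in> interior C"
  shows
    "(\<forall>r. r \<ge> circumradius K' C \<and> K \<subseteq> K' \<longrightarrow>
        ball_intersection K C r \<supseteq> ball_intersection K' C r \<and>
        ball_hull K C r \<subseteq> ball_hull K' C r) \<and>
     (\<forall>r r'. circumradius K C \<le> r \<and> r \<le> r' \<longrightarrow>
        ball_intersection K C r \<subseteq> ball_intersection K C r' \<and>
        ball_hull K C r \<supseteq> ball_hull K C r') \<and>
     (\<forall>r. r \<ge> circumradius K C \<and> ball_hull K C r \<noteq> {} \<and> ball_intersection K C r \<noteq> {} \<longrightarrow>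
        ball_hull K C r = ball_intersection (ball_intersection K C r) (reflect C) r \<and>
        ball_intersection K C r = ball_intersection (ball_hull K C r) C r) \<and>
     (\<forall>r. Sup {minkowski_functional C (x - y) | x y. x \<in> K \<and> y \<in> K} = r \<longrightarrow>
        ball_hull K C r \<subseteq> ball_intersection K (reflect C) r)"
proof (intro conjI allI impI; (elim conjE)?)
  have C0: "0 \<in> C" using assms(5) interior_subset by auto
  fix r r'
  assume r: "circumradius K C \<le> r" "r \<le> r'"
  \<comment> \<open>The radius lemmas ask for \<open>0 <= r\<close>, which the circumradius bound
    supplies.\<close>
  then have "0 \<le> r" using circumradius_nonneg[OF assms(1,5)] by simp
  then show "ball_intersection K C r \<subseteq> ball_intersection K C r'"
    and "ball_hull K C r' \<subseteq> ball_hull K C r"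
    using ball_intersection_mono_radius[OF assms(4) C0] ball_hull_antimono_radius[OF assms(3-5)] r
    by blast+
\<comment> \<open>Five goals remain: monotonicity in \<open>K\<close>, the two duality identities
  and the diameter inclusion.\<close>
qed (rule ball_intersection_antimono ball_hull_mono ball_hull_eq_ball_intersection
    ball_intersection_ball_hull[symmetric]
    ball_hull_subset_ball_intersection_reflect[OF assms(1,3-5)]; assumption?)+

end
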